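(* Suppose that $(x_k)_{k\in\mathbb{N}}$ is a sequence generated by tPLDCA and that $\bar x$ is a cluster point of it. Then: (a) $\lim_{k\to+\infty}f(x_k)=f(\bar x)$; (b) $\bar x$ is a critical point of $f$, i.e. $\partial g(\bar x)\cap\partial h(\bar x)\neq\emptyset$.
   Context: Notation: $\mathbb{N}=\{0,1,2,\dots\}$; $\langle\cdot,\cdot\rangle$ and $\|\cdot\|$ are the inner product and Euclidean norm on $\mathbb{R}^n$. $\Gamma_0(\mathbb{R}^n)$ is the set of proper, lower semicontinuous, convex functions $\mathbb{R}^n\to\mathbb{R}\cup\{+\infty\}$; $\mathrm{dom}\,\phi=\{x:\phi(x)<+\infty\}$. For $\phi\in\Gamma_0(\mathbb{R}^n)$, $x\in\mathrm{dom}\,\phi$, $\epsilon>0$: $\partial\phi(x)=\{s:\phi(y)\ge\phi(x)+\langle s,y-x\rangle\ \forall y\in\mathbb{R}^n\}$ and $\partial_\epsilon\phi(x)=\{s:\phi(y)\ge\phi(x)+\langle s,y-x\rangle-\epsilon\ \forall y\in\mathbb{R}^n\}$; for $\epsilon=0$, $\partial_0\phi=\partial\phi$. For a nonempty closed set $S$, $\mathrm{dist}(x,S)=\min_{y\in S}\|x-y\|$. Standing assumptions: $g,h\in\Gamma_0(\mathbb{R}^n)$, $f=g-h$, and (1) $\inf_{x\in\mathbb{R}^n} f(x)>-\infty$; (2) $\mathrm{dom}\,h=\mathbb{R}^n$; (3) $g=g_0+\iota_C$, where $g_0\in\Gamma_0(\mathbb{R}^n)$ has $\mathrm{dom}\,g_0=\mathbb{R}^n$,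 $C\subset\mathbb{R}^n$ is nonempty closed convex, and $\iota_C$ is $0$ on $C$ and $+\infty$ elsewhere; (4) there is an inner iterative algorithm $T_g$ such that for any $(x_k,u_k,\lambda_k)\in\mathrm{dom}\,g\times\mathbb{R}^n\times(0,\infty)$, $T_g(x_k,u_k,\lambda_k)$ generates a sequence $(z_i)_{i\in\mathbb{N}}$ in $\mathrm{dom}\,g$ converging to a solution $\bar z_k\in\mathrm{dom}\,g$ of the proximal point subproblem (PP): minimize over $z\in\mathbb{R}^n$ the function $\tilde f_k(z)=g(z)-\langle u_k,z-x_k\rangle+\frac{1}{2\lambda_k}\|z-x_k\|^2$; i.e. $0\in\partial\tilde f_k(\bar z_k)=\partial g(\bar z_k)-u_k+\frac{1}{\lambda_k}(\bar z_k-x_k)$. Algorithm tPLDCA. Parameters: $\sigma\in(0,1)$, $\lambda>0$, $\theta>\frac1\lambda$, $\rho\in[0,\frac{1-\sigma}{\lambda})$, $\gamma\in[0,\frac{1-\sigma}{\lambda}-\rho)$, $\lambda_k=\lambda$ for all $k\in\mathbb{N}$, and positive numbers $(\zeta_k)_{k\in\mathbb{N}}$ with $\zeta_k\to0$. Start with $x_{-1},x_0\in\mathrm{dom}\,f=\{x:f(x)<+\infty\}$ and for $k=0,1,2,\dots$ do: Step 1: find $u_k\in\mathbb{R}^n$ with $\mathrm{dist}(u_k,\partial_{\epsilon_k}h(x_k))\le d_k$, where $\epsilon_k=\rho\|x_k-x_{k-1}\|^2$ and $d_k=\gamma\|x_k-x_{k-1}\|$. Step 2: set $z_{-1}=x_k$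 and generate $z_0,z_1,\dots$ by $T_g(x_k,u_k,\lambda_k)$ until, for some $i\in\{-1\}\cup\mathbb{N}$, both $g(x_k)-g(z_i)-\langle u_k,x_k-z_i\rangle\ge\frac{1-\sigma}{\lambda_k}\|z_i-x_k\|^2$ and $\mathrm{dist}(u_k,\partial_{\zeta_k}g(z_i))\le\theta\|z_i-x_k\|$ hold; then set $x_{k+1}=z_i$. *)

theory Defs
  imports "HOL-Analysis.Analysis"
begin

definition edom :: "('a \<Rightarrow> ereal) \<Rightarrow> 'a set" where
  "edom \<phi> = {x. \<phi> x < \<infinity>}"

definition proper_fun :: "('a \<Rightarrow> ereal) \<Rightarrow> bool" where
  "proper_fun \<phi> \<longleftrightarrow> (\<forall>x. \<phi> x \<noteq> -\<infinity>) \<and> edom \<phi> \<noteq> {}"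

definition lsc_fun :: "('a::topological_space \<Rightarrow> ereal) \<Rightarrow> bool" where
  "lsc_fun \<phi> \<longleftrightarrow> (\<forall>x. \<phi> x \<le> Liminf (at x) \<phi>)"

definition econvex :: "('a::real_vector \<Rightarrow> ereal) \<Rightarrow> bool" where
  "econvex \<phi> \<longleftrightarrow> (\<forall>x y t. 0 < t \<and> t < 1 \<longrightarrow>
     \<phi> ((1 - t) *\<^sub>R x + t *\<^sub>R y) \<le> ereal (1 - t) * \<phi> x + ereal t * \<phi> y)"

definition Gamma0 :: "('a::real_inner \<Rightarrow> ereal) set" where
  "Gamma0 = {\<phi>. proper_fun \<phi> \<and> lsc_fun \<phi> \<and> econvex \<phi>}"

definition indicator_fun :: "'a set \<Rightarrow> 'a \<Rightarrow> ereal" where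
  "indicator_fun C x = (if x \<in> C then 0 else \<infinity>)"

definition subdiff :: "('a::real_inner \<Rightarrow> ereal) \<Rightarrow> 'a \<Rightarrow> 'a set" where
  "subdiff \<phi> x = {s. \<forall>y. \<phi> y \<ge> \<phi> x + ereal (s \<bullet> (y - x))}"

definition eps_subdiff :: "real \<Rightarrow> ('a::real_inner \<Rightarrow> ereal) \<Rightarrow> 'a \<Rightarrow> 'a set" where
  "eps_subdiff \<epsilon> \<phi> x = {s. \<forall>y. \<phi> y \<ge> \<phi> x + ereal (s \<bullet> (y - x)) - ereal \<epsilon>}"

lemma eps_subdiff_0: "eps_subdiff 0 \<phi> x = subdiff \<phi> x"
  by (simp add: eps_subdiff_def subdiff_def flip: zero_ereal_def)

definition critical_point ::
    "('a::real_inner \<Rightarrow> ereal) \<Rightarrow> ('a \<Rightarrow> ereal) \<Rightarrow> 'a \<Rightarrow> bool" where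
  "critical_point g h x \<longleftrightarrow> subdiff g x \<inter> subdiff h x \<noteq> {}"

definition prox_objective ::
    "('a::real_inner \<Rightarrow> ereal) \<Rightarrow> 'a \<Rightarrow> 'a \<Rightarrow> real \<Rightarrow> 'a \<Rightarrow> ereal" where
  "prox_objective g x u l z =
     g z - ereal (u \<bullet> (z - x)) + ereal (1 / (2 * l) * (norm (z - x))\<^sup>2)"

definition prox_solution ::
    "('a::real_inner \<Rightarrow> ereal) \<Rightarrow> 'a \<Rightarrow> 'a \<Rightarrow> real \<Rightarrow> 'a \<Rightarrow> bool" where
  "prox_solution g x u l z \<longleftrightarrow> is_arg_min (prox_objective g x u l) (\<lambda>_. True) z"

lemma prox_solution_iff_zero_subdiff:
  "prox_solution g x u l z \<longleftrightarrow> 0 \<in> subdiff (prox_objective g x u l) z"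
  by (auto simp: prox_solution_def is_arg_min_def subdiff_def not_less simp flip: zero_ereal_def)

definition inner_algorithm ::
    "('a::real_inner \<Rightarrow> ereal) \<Rightarrow> ('a \<Rightarrow> 'a \<Rightarrow> real \<Rightarrow> nat \<Rightarrow> 'a) \<Rightarrow> bool" where
  "inner_algorithm g T \<longleftrightarrow> (\<forall>x u l. x \<in> edom g \<and> l > 0 \<longrightarrow>
     (\<forall>i. T x u l i \<in> edom g) \<and>
     (\<exists>z \<in> edom g. T x u l \<longlonglongrightarrow> z \<and> prox_solution g x u l z))"

text \<open>Prepends the term with index -1 to a sequence: entry \<open>k\<close> of \<open>shift a s\<close>
  is \<open>s\<close> at index \<open>k - 1\<close>, with \<open>a\<close> at index -1.\<close>
definition shift :: "'a \<Rightarrow> (nat \<Rightarrow> 'a) \<Rightarrow> nat \<Rightarrow> 'a" where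
  "shift a s = case_nat a s"

text \<open>The library's \<^const>\<open>infdist\<close> is 0 for the empty set. For \<open>g\<close>, \<open>h\<close> in
  \<^const>\<open>Gamma0\<close> with \<open>h\<close> finite everywhere, and positive \<open>\<zeta> k\<close>, the sets below
  are nonempty and closed (all points involved lie in \<open>edom g\<close>), so it is the minimal distance.
  The index \<open>i\<close> in the second step stands for the inner index \<open>i - 1\<close>. Any index passing
  both tests is allowed, in particular the first one.\<close>
definition tPLDCA_sequence ::
    "('a::euclidean_space \<Rightarrow> ereal) \<Rightarrow> ('a \<Rightarrow> ereal) \<Rightarrow> ('a \<Rightarrow> 'a \<Rightarrow> real \<Rightarrow> nat \<Rightarrow> 'a) \<Rightarrow>
     real \<Rightarrow> real \<Rightarrow> real \<Rightarrow> real \<Rightarrow> real \<Rightarrow> (nat \<Rightarrow> real) \<Rightarrow> 'a \<Rightarrow> (nat \<Rightarrow> 'a) \<Rightarrow> bool" where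
  "tPLDCA_sequence g h T \<sigma> l \<theta> \<rho> \<gamma> \<zeta> xm1 x \<longleftrightarrow>
     xm1 \<in> edom (\<lambda>y. g y - h y) \<and> x 0 \<in> edom (\<lambda>y. g y - h y) \<and>
     (\<forall>k. \<exists>u.
        infdist u (eps_subdiff (\<rho> * (norm (x k - shift xm1 x k))\<^sup>2) h (x k))
          \<le> \<gamma> * norm (x k - shift xm1 x k) \<and>
        (\<exists>i z. z = shift (x k) (T (x k) u l) i \<and>
           g (x k) - g z - ereal (u \<bullet> (x k - z)) \<ge> ereal ((1 - \<sigma>) / l * (norm (z - x k))\<^sup>2) \<and>
           infdist u (eps_subdiff (\<zeta> k) g z) \<le> \<theta> * norm (z - x k) \<and>
           x (Suc k) = z))"

definition cluster_point :: "(nat \<Rightarrow> 'a::topological_space) \<Rightarrow> 'a \<Rightarrow> bool" where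
  "cluster_point x a \<longleftrightarrow> (\<exists>r. strict_mono r \<and> (x \<circ> r) \<longlonglongrightarrow> a)"

end

theory Submission
  imports Defs
begin

text \<open>Up to errors controlled by the last two step lengths, every step of the algorithm decreases
  \<open>f\<close> by at least a multiple of the squared step length. Adding a suitable multiple of the last
  squared step length to \<open>f\<close> therefore gives a decreasing energy, which is bounded below; so the
  step lengths tend to zero and \<open>f (x k)\<close> converges, by continuity of \<open>f\<close> on \<open>C\<close> to the value at
  the cluster point. Approximate subgradients of the finite convex function \<open>h\<close> at points of a
  bounded set are bounded, so a subsequence of them converges; as the step lengths vanish, its limit
  is a subgradient of both \<open>h\<close> and \<open>g\<close> at the cluster point.\<close>

section \<open>Preliminaries on finite convex functions and on real sequences\<close>

lemma Gamma0_finite_real: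
  assumes "\<phi> \<in> Gamma0" and "edom \<phi> = UNIV"
  obtains F where "\<phi> = (\<lambda>y. ereal (F y))" and "convex_on UNIV F"
proof
  have fin: "\<bar>\<phi> y\<bar> \<noteq> \<infinity>" for y
    using assms by (auto simp: Gamma0_def proper_fun_def edom_def set_eq_iff)
  then have eq: "\<phi> y = ereal (real_of_ereal (\<phi> y))" for y
    by (simp add: ereal_real)
  then show "\<phi> = (\<lambda>y. ereal (real_of_ereal (\<phi> y)))"
    by blast
  have "\<phi> ((1 - t) *\<^sub>R x + t *\<^sub>R y) \<le> ereal (1 - t) * \<phi> x + ereal t * \<phi> y"
    if "0 < t" "t < 1" for t x y
    using assms(1) that by (auto simp: Gamma0_def econvex_def)
  then have "real_of_ereal (\<phi> ((1 - t) *\<^sub>R x + t *\<^sub>R y))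
      \<le> (1 - t) * real_of_ereal (\<phi> x) + t * real_of_ereal (\<phi> y)"
    if "0 < t" "t < 1" for t x y
    using that by (metis eq ereal_less_eq(3) plus_ereal.simps(1) times_ereal.simps(1))
  then show "convex_on UNIV (\<lambda>y. real_of_ereal (\<phi> y))"
    by (intro convex_onI) auto
qed

text \<open>A hyperplane separates the vertical ray strictly below the graph point at
  \<open>x\<close> from the epigraph. As \<open>F\<close> is finite everywhere, the hyperplane is
  not vertical, and dividing by its last coefficient \<open>q\<close> gives the slope.\<close>

lemma convex_on_UNIV_subgradient:
  fixes F :: "'a::euclidean_space \<Rightarrow> real"
  assumes "convex_on UNIV F"
  obtains s where "\<And>y. F y \<ge> F x + s \<bullet> (y - x)"
proof -
  have "convex ({x} \<times> {..<F x})" and "convex (epigraph UNIV F)"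
    using assms by (auto intro!: convex_Times simp: convex_epigraph)
  moreover have "{x} \<times> {..<F x} \<noteq> {}" and "epigraph UNIV F \<noteq> {}"
    by (auto simp: epigraph_def intro: lt_ex)
  moreover have "({x} \<times> {..<F x}) \<inter> epigraph UNIV F = {}"
    by (auto simp: epigraph_def)
  ultimately obtain a b where "a \<noteq> 0" and ab: "\<forall>z\<in>{x} \<times> {..<F x}. a \<bullet> z \<le> b"
      "\<forall>z\<in>epigraph UNIV F. b \<le> a \<bullet> z"
    using separating_hyperplane_sets by metis
  obtain p q where a: "a = (p, q)" by force
  have below: "p \<bullet> x + q * t \<le> b" if "t < F x" for t
    using ab(1) that by (auto simp: a)
  have above: "b \<le> p \<bullet> y + q * t" if "F y \<le> t" for y t
    using ab(2) that by (auto simp: a epigraph_def)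
  have "p \<bullet> x + q * (F x - 1) \<le> p \<bullet> x + q * F x"
    using below[of "F x - 1"] above[of x "F x"] by simp
  then have "q \<ge> 0"
    by (simp add: algebra_simps)
  \<comment> \<open>A vertical hyperplane would bound \<open>p \<bullet> y\<close> from below by
    \<open>p \<bullet> x\<close> for every \<open>y\<close>; the test point \<open>x - p\<close>
    then forces \<open>p\<close> to vanish.\<close>
  moreover have "q \<noteq> 0"
  proof
    assume "q = 0"
    then have "p \<bullet> x \<le> p \<bullet> (x - p)"
      using below[of "F x - 1"] above[of "x - p" "F (x - p)"] by simp
    then have "p = 0"
      by (simp add: inner_diff_right) (metis inner_eq_zero_iff inner_ge_zero order_antisym)
    with \<open>q = 0\<close> \<open>a \<noteq> 0\<close> show False
      by (simp add: a zero_prod_def)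
  qed
  ultimately have "q > 0" by simp
  \<comment> \<open>The ray omits its endpoint \<open>F x\<close>, so the bound reaches it only by
    density.\<close>
  have "F x \<le> (b - p \<bullet> x) / q"
  proof (rule dense_le)
    fix t assume "t < F x"
    from below[OF this] show "t \<le> (b - p \<bullet> x) / q"
      using \<open>q > 0\<close> by (simp add: field_simps)
  qed
  then have "q * F x \<le> b - p \<bullet> x"
    using \<open>q > 0\<close> by (simp add: field_simps)
  moreover have "q * (F x + (- p /\<^sub>R q) \<bullet> (y - x)) = q * F x - p \<bullet> (y - x)" for y
    using \<open>q > 0\<close> by (simp add: right_diff_distrib flip: mult.assoc)
  ultimately have "q * (F x + (- p /\<^sub>R q) \<bullet> (y - x)) \<le> q * F y" for y
    using above[of y "F y"] by (simp add: inner_diff_right)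
  then have "F y \<ge> F x + (- p /\<^sub>R q) \<bullet> (y - x)" for y
    using \<open>q > 0\<close> by simp
  then show ?thesis
    by (rule that)
qed

text \<open>Since \<open>infdist\<close> to the empty set is 0, the distance test carries
  information only once the set is known to be nonempty: an exact subgradient of \<open>F\<close>
  lies in it. Being cut out by non-strict affine inequalities, the set is closed, so the distance is
  attained.\<close>

lemma infdist_eps_subdiff_attained:
  fixes F :: "'a::euclidean_space \<Rightarrow> real"
  assumes "convex_on UNIV F" and "x \<in> C" and "0 \<le> \<epsilon>"
    and "infdist u (eps_subdiff \<epsilon> (\<lambda>y. ereal (F y) + indicator_fun C y) x) \<le> d"
  obtains s where "norm (u - s) \<le> d" and "\<And>y. y \<in> C \<Longrightarrow> F y \<ge> F x + s \<bullet> (y - x) - \<epsilon>"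
proof -
  let ?S = "{s. \<forall>y\<in>C. F x + s \<bullet> (y - x) - \<epsilon> \<le> F y}"
  have "eps_subdiff \<epsilon> (\<lambda>y. ereal (F y) + indicator_fun C y) x = ?S"
    using \<open>x \<in> C\<close> by (auto simp: eps_subdiff_def indicator_fun_def)
  moreover have "closed ?S"
    by (auto simp: Collect_ball_eq intro!: closed_INT closed_Collect_le continuous_intros)
  moreover have "?S \<noteq> {}"
  proof -
    obtain s where "\<And>y. F y \<ge> F x + s \<bullet> (y - x)"
      using convex_on_UNIV_subgradient[OF assms(1)] by blast
    then have "F x + s \<bullet> (y - x) - \<epsilon> \<le> F y" for y
      using \<open>0 \<le> \<epsilon>\<close> by (metis add.commute add_increasing diff_le_eq)
    then show ?thesis by blast
  qed
  ultimately obtain s where "s \<in> ?S" and "dist u s \<le> d"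
    using infdist_attains_inf[of ?S u] assms(4) by metis
  then show ?thesis
    using that[of s] by (auto simp: dist_norm)
qed

text \<open>Testing the inequality at \<open>x k\<close> plus the unit vector in direction
  \<open>v k\<close> isolates \<open>norm (v k)\<close>. All points involved lie in a ball of radius
  \<open>R + 1\<close>, on which \<open>F\<close> is bounded by compactness.\<close>

lemma bounded_eps_subgradients:
  fixes F :: "'a::euclidean_space \<Rightarrow> real"
  assumes "continuous_on UNIV F" and "bounded (range x)" and "bounded (range e)"
    and "\<And>k y. F y \<ge> F (x k) + v k \<bullet> (y - x k) - e k"
  shows "bounded (range v)"
proof -
  obtain R where R: "\<And>k. norm (x k) \<le> R"
    using assms(2) by (auto simp: bounded_iff)
  obtain E where E: "\<And>k. \<bar>e k\<bar> \<le> E"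
    using assms(3) by (auto simp: bounded_iff)
  have "compact (F ` cball 0 (R + 1))"
    using assms(1) by (intro compact_continuous_image) (auto intro: continuous_on_subset)
  then obtain M where "\<forall>z\<in>F ` cball 0 (R + 1). norm z \<le> M"
    using compact_imp_bounded bounded_iff by metis
  then have M: "\<bar>F y\<bar> \<le> M" if "norm y \<le> R + 1" for y
    using that by simp
  have "norm (v k) \<le> M + M + E" for k
  proof -
    let ?y = "x k + sgn (v k)"
    have "norm ?y \<le> R + 1"
      using R[of k] norm_triangle_ineq[of "x k" "sgn (v k)"] by (simp add: norm_sgn split: if_splits)
    moreover have "norm (x k) \<le> R + 1"
      using R[of k] by simp
    moreover have "v k \<bullet> sgn (v k) = norm (v k)"
      by (cases "v k = 0") (simp_all add: sgn_div_norm dot_square_norm power2_eq_square)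
    ultimately show ?thesis
      using assms(4)[of k ?y] M[of ?y] M[of "x k"] E[of k] by simp
  qed
  then show ?thesis
    by (auto simp: bounded_iff)
qed

text \<open>The cross term is at most \<gamma>/2 times the sum of the two squares. Hence \<rho> +
  \<gamma>/2 is the multiple of the last squared step to add to \<open>F\<close>, and the energy
  loses at least c - \<rho> - \<gamma> times the new squared step.\<close>

lemma perturbed_descent_converges:
  fixes F a :: "nat \<Rightarrow> real"
  assumes descent: "\<And>k. F k - F (Suc k) \<ge> c * (a (Suc k))\<^sup>2 - \<rho> * (a k)\<^sup>2 - \<gamma> * a k * a (Suc k)"
    and lower: "\<And>k. m \<le> F k" and "0 \<le> \<rho>" and "0 \<le> \<gamma>" and "\<rho> + \<gamma> < c"
  shows "a \<longlonglongrightarrow> 0" and "convergent F"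
proof -
  define E where "E k = F k + (\<rho> + \<gamma> / 2) * (a k)\<^sup>2" for k
  have step: "(c - \<rho> - \<gamma>) * (a (Suc k))\<^sup>2 \<le> E k - E (Suc k)" for k
  proof -
    have "0 \<le> \<gamma> / 2 * (a k - a (Suc k))\<^sup>2"
      using \<open>0 \<le> \<gamma>\<close> by simp
    then show ?thesis
      using descent[of k] by (simp add: E_def power2_eq_square algebra_simps)
  qed
  have "0 \<le> (c - \<rho> - \<gamma>) * (a (Suc k))\<^sup>2" for k
    using \<open>\<rho> + \<gamma> < c\<close> by simp
  then have "decseq E"
    using step by (intro decseq_SucI) (smt (verit))
  moreover have "m \<le> E k" for k
    using lower[of k] \<open>0 \<le> \<rho>\<close> \<open>0 \<le> \<gamma>\<close> by (simp add: E_def add_increasing2)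
  ultimately obtain L where L: "E \<longlonglongrightarrow> L"
    by (metis decseq_convergent)
  then have "(\<lambda>k. E k - E (Suc k)) \<longlonglongrightarrow> 0"
    using tendsto_diff[OF L LIMSEQ_Suc[OF L]] by simp
  then have lim: "(\<lambda>k. (E k - E (Suc k)) / (c - \<rho> - \<gamma>)) \<longlonglongrightarrow> 0"
    by (rule tendsto_divide_zero)
  have "norm ((a (Suc k))\<^sup>2) \<le> (E k - E (Suc k)) / (c - \<rho> - \<gamma>)" for k
    using step[of k] \<open>\<rho> + \<gamma> < c\<close> by (simp add: field_simps)
  then have "(\<lambda>k. (a (Suc k))\<^sup>2) \<longlonglongrightarrow> 0"
    by (intro Lim_null_comparison[OF _ lim] always_eventually) blast
  then have a2: "(\<lambda>k. (a k)\<^sup>2) \<longlonglongrightarrow> 0"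
    by (rule LIMSEQ_imp_Suc)
  then show "a \<longlonglongrightarrow> 0"
    by simp
  have "(\<lambda>k. E k - (\<rho> + \<gamma> / 2) * (a k)\<^sup>2) \<longlonglongrightarrow> L - (\<rho> + \<gamma> / 2) * 0"
    by (intro tendsto_intros L a2)
  then show "convergent F"
    by (auto simp: E_def convergent_def)
qed

lemma tendsto_perturb:
  fixes v :: "nat \<Rightarrow> 'a::real_normed_vector"
  assumes "v \<longlonglongrightarrow> a" and "\<And>k. norm (w k - v k) \<le> e k" and "e \<longlonglongrightarrow> 0"
  shows "w \<longlonglongrightarrow> a"
proof -
  have "(\<lambda>k. w k - v k) \<longlonglongrightarrow> 0"
    using assms(2) by (intro Lim_null_comparison[OF _ assms(3)] always_eventually) blast
  from tendsto_add[OF this assms(1)] show ?thesis by simp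
qed


theorem theorem4p7:
  fixes g h g0 f :: "real ^ 'n \<Rightarrow> ereal"
    and C :: "(real ^ 'n) set"
    and T :: "real ^ 'n \<Rightarrow> real ^ 'n \<Rightarrow> real \<Rightarrow> nat \<Rightarrow> real ^ 'n"
    and \<sigma> l \<theta> \<rho> \<gamma> :: real
    and \<zeta> :: "nat \<Rightarrow> real"
    and xm1 xbar :: "real ^ 'n"
    and x :: "nat \<Rightarrow> real ^ 'n"
  assumes "g \<in> Gamma0" and "h \<in> Gamma0"
    and "f = (\<lambda>y. g y - h y)"
    and "(INF y. f y) > -\<infinity>"
    and "edom h = UNIV"
    and "g0 \<in> Gamma0" and "edom g0 = UNIV"
    and "C \<noteq> {}" and "closed C" and "convex C"
    and "g = (\<lambda>y. g0 y + indicator_fun C y)"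
    and "inner_algorithm g T"
    and "0 < \<sigma>" and "\<sigma> < 1"
    and "l > 0"
    and "\<theta> > 1 / l"
    and "0 \<le> \<rho>" and "\<rho> < (1 - \<sigma>) / l"
    and "0 \<le> \<gamma>" and "\<gamma> < (1 - \<sigma>) / l - \<rho>"
    and "\<And>k. \<zeta> k > 0" and "\<zeta> \<longlonglongrightarrow> 0"
    and "tPLDCA_sequence g h T \<sigma> l \<theta> \<rho> \<gamma> \<zeta> xm1 x"
    and "cluster_point x xbar"
  shows "(\<lambda>k. f (x k)) \<longlonglongrightarrow> f xbar \<and> critical_point g h xbar"
proof -

  \<comment> \<open>Reduction to real-valued convex functions\<close>
  obtain H where h: "h = (\<lambda>y. ereal (H y))" and cH: "convex_on UNIV H"
    using Gamma0_finite_real[OF assms(2,5)] .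
  obtain G where g0: "g0 = (\<lambda>y. ereal (G y))" and cG: "convex_on UNIV G"
    using Gamma0_finite_real[OF assms(6,7)] .
  have g: "g = (\<lambda>y. ereal (G y) + indicator_fun C y)"
    using assms(11) by (simp add: g0)
  \<comment> \<open>The vacuous indicator lets one attainment lemma serve both \<open>h\<close> and
    \<open>g\<close>.\<close>
  have h': "h = (\<lambda>y. ereal (H y) + indicator_fun UNIV y)"
    by (simp add: h indicator_fun_def)
  have gC: "g y = (if y \<in> C then ereal (G y) else \<infinity>)" for y
    by (simp add: g indicator_fun_def)
  have fC: "f y = ereal (G y - H y)" if "y \<in> C" for y
    using that by (simp add: assms(3) h gC)
  have edom_f: "edom f = C" and edom_g: "edom g = C"
    by (auto simp: edom_def assms(3) h gC split: if_splits)
  have contG: "continuous_on UNIV G" and contH: "continuous_on UNIV H"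
    using cG cH convex_on_continuous open_UNIV by blast+

  \<comment> \<open>Step lengths, feasibility and nearby approximate subgradients\<close>
  define a where "a k = norm (x k - shift xm1 x k)" for k
  have a_Suc: "a (Suc k) = norm (x (Suc k) - x k)" for k
    by (simp add: a_def shift_def)
  note seq = assms(23)[unfolded tPLDCA_sequence_def, folded assms(3) a_def]
  define c where "c = (1 - \<sigma>) / l"
  obtain u where u: "\<And>k. infdist (u k) (eps_subdiff (\<rho> * (a k)\<^sup>2) h (x k)) \<le> \<gamma> * a k"
    and inner: "\<And>k. \<exists>i. x (Suc k) = shift (x k) (T (x k) (u k) l) i"
    and dec: "\<And>k. g (x k) - g (x (Suc k)) - ereal (u k \<bullet> (x k - x (Suc k)))
        \<ge> ereal (c * (a (Suc k))\<^sup>2)"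
    and u': "\<And>k. infdist (u k) (eps_subdiff (\<zeta> k) g (x (Suc k))) \<le> \<theta> * a (Suc k)"
    using seq unfolding a_Suc c_def by metis

  \<comment> \<open>Index 0 of \<open>shift\<close> returns \<open>x k\<close> itself, every later
    index an inner iterate; both stay in the domain of \<open>g\<close>.\<close>
  have xC: "x k \<in> C" for k
  proof (induction k)
    case 0
    show ?case using seq by (simp add: edom_f)
  next
    case (Suc k)
    obtain i where "x (Suc k) = shift (x k) (T (x k) (u k) l) i"
      using inner by blast
    with Suc show ?case
      using assms(12,15) by (auto simp: inner_algorithm_def edom_g shift_def split: nat.split)
  qed

  have "\<exists>v. norm (u k - v) \<le> \<gamma> * a k \<and> (\<forall>y. H y \<ge> H (x k) + v \<bullet> (y - x k) - \<rho> * (a k)\<^sup>2)" for k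
    using infdist_eps_subdiff_attained[OF cH, of "x k" UNIV, folded h'] u[of k] \<open>0 \<le> \<rho>\<close>
    by (metis UNIV_I mult_nonneg_nonneg zero_le_power2)
  then obtain v where uv: "\<And>k. norm (u k - v k) \<le> \<gamma> * a k"
    and v: "\<And>k y. H y \<ge> H (x k) + v k \<bullet> (y - x k) - \<rho> * (a k)\<^sup>2"
    by metis
  have "\<exists>w. norm (u k - w) \<le> \<theta> * a (Suc k) \<and>
      (\<forall>y\<in>C. G y \<ge> G (x (Suc k)) + w \<bullet> (y - x (Suc k)) - \<zeta> k)" for k
    using infdist_eps_subdiff_attained[OF cG xC, of "\<zeta> k", folded g] u'[of k] assms(21)[of k]
    by (metis less_imp_le)
  then obtain w where uw: "\<And>k. norm (u k - w k) \<le> \<theta> * a (Suc k)"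
    and w: "\<And>k y. y \<in> C \<Longrightarrow> G y \<ge> G (x (Suc k)) + w k \<bullet> (y - x (Suc k)) - \<zeta> k"
    by metis

  \<comment> \<open>Descent and vanishing step lengths\<close>
  define \<Phi> where "\<Phi> y = G y - H y" for y
  have descent: "\<Phi> (x k) - \<Phi> (x (Suc k)) \<ge> c * (a (Suc k))\<^sup>2 - \<rho> * (a k)\<^sup>2 - \<gamma> * a k * a (Suc k)" for k
  proof -
    \<comment> \<open>The acceptance test bounds the decrease of \<open>G\<close> with slope
      \<open>u k\<close>, while the inequality for \<open>H\<close> has slope \<open>v k\<close>;
      Cauchy-Schwarz pays for the mismatch.\<close>
    have "(u k - v k) \<bullet> (x (Suc k) - x k) \<le> norm (u k - v k) * a (Suc k)"
      unfolding a_Suc by (rule norm_cauchy_schwarz)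
    also have "\<dots> \<le> \<gamma> * a k * a (Suc k)"
      using uv by (intro mult_right_mono) (auto simp: a_def)
    finally have "(u k - v k) \<bullet> (x (Suc k) - x k) \<le> \<gamma> * a k * a (Suc k)" .
    moreover have "G (x k) - G (x (Suc k)) - u k \<bullet> (x k - x (Suc k)) \<ge> c * (a (Suc k))\<^sup>2"
      using dec[of k] by (simp add: gC xC)
    ultimately show ?thesis
      using v[where k=k and y="x (Suc k)"] by (simp add: \<Phi>_def inner_diff_left inner_diff_right)
  qed
  obtain m where m: "ereal m < (INF y. f y)"
    using assms(4) ereal_dense2 by blast
  have lower: "m \<le> \<Phi> (x k)" for k
  proof -
    have "ereal m < f (x k)"
      using m by (meson INF_lower UNIV_I less_le_trans)
    then show ?thesis by (simp add: fC xC \<Phi>_def)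
  qed
  have a0: "a \<longlonglongrightarrow> 0" and conv: "convergent (\<lambda>k. \<Phi> (x k))"
    using perturbed_descent_converges[where F="\<lambda>k. \<Phi> (x k)", OF descent lower]
      \<open>0 \<le> \<rho>\<close> \<open>0 \<le> \<gamma>\<close> assms(20) by (auto simp: c_def)

  \<comment> \<open>Limit of the function values\<close>
  obtain r where r: "strict_mono r" "(x \<circ> r) \<longlonglongrightarrow> xbar"
    using assms(24) by (auto simp: cluster_point_def)
  have xbar: "xbar \<in> C"
    using closed_sequentially[OF assms(9) _ r(2)] xC by simp
  have "isCont \<Phi> xbar"
    using contG contH unfolding \<Phi>_def by (auto simp: continuous_on_eq_continuous_at)
  then have subseq: "(\<lambda>j. \<Phi> (x (r j))) \<longlonglongrightarrow> \<Phi> xbar"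
    using isCont_tendsto_compose[OF _ r(2)] by (simp add: o_def)
  \<comment> \<open>The full sequence of values already converges, so the subsequence only has to
    identify its limit.\<close>
  obtain L where L: "(\<lambda>k. \<Phi> (x k)) \<longlonglongrightarrow> L"
    using conv by (auto simp: convergent_def)
  have "(\<lambda>j. \<Phi> (x (r j))) \<longlonglongrightarrow> L"
    using LIMSEQ_subseq_LIMSEQ[OF L r(1)] by (simp add: o_def)
  with subseq have "L = \<Phi> xbar"
    by (rule LIMSEQ_unique[symmetric])
  then have "(\<lambda>k. f (x k)) \<longlonglongrightarrow> f xbar"
    using L by (simp add: fC xC xbar \<Phi>_def)

  \<comment> \<open>Criticality of the cluster point\<close>
  moreover have "critical_point g h xbar"
  proof -
    have e0: "(\<lambda>k. \<rho> * (a k)\<^sup>2) \<longlonglongrightarrow> 0"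
      using a0 by (auto intro!: tendsto_eq_intros)
    have "bounded (range (\<lambda>j. v (r j)))"
    proof (rule bounded_eps_subgradients[OF contH])
      show "bounded (range (\<lambda>j. x (r j)))"
        using convergent_imp_bounded[OF r(2)] by (simp add: o_def)
      show "bounded (range (\<lambda>j. \<rho> * (a (r j))\<^sup>2))"
        using convergent_imp_bounded[OF LIMSEQ_subseq_LIMSEQ[OF e0 r(1)]] by (simp add: o_def)
    qed (rule v)
    then obtain s q where q: "strict_mono q" "(\<lambda>j. v (r (q j))) \<longlonglongrightarrow> s"
      using bounded_imp_convergent_subsequence by (force simp: o_def)
    define p where "p = r \<circ> q"
    have p: "strict_mono p"
      using r(1) q(1) by (simp add: p_def strict_mono_o)
    have sub: "(\<lambda>j. X (p j)) \<longlonglongrightarrow> b" if "X \<longlonglongrightarrow> b" for X :: "nat \<Rightarrow> real" and b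
      using LIMSEQ_subseq_LIMSEQ[OF that p] by (simp add: o_def)
    have xp: "(\<lambda>j. x (p j)) \<longlonglongrightarrow> xbar"
      using LIMSEQ_subseq_LIMSEQ[OF r(2) q(1)] by (simp add: p_def o_def)
    have vp: "(\<lambda>j. v (p j)) \<longlonglongrightarrow> s"
      using q(2) by (simp add: p_def)
    have aS: "(\<lambda>k. a (Suc k)) \<longlonglongrightarrow> 0"
      using LIMSEQ_Suc[OF a0] .
    \<comment> \<open>The approximate subgradient \<open>w k\<close> of \<open>g\<close> belongs to
      the next iterate, so the shifted subsequence must have the same limit.\<close>
    have xSp: "(\<lambda>j. x (Suc (p j))) \<longlonglongrightarrow> xbar"
      by (rule tendsto_perturb[OF xp _ sub[OF aS]]) (simp add: a_Suc)
    \<comment> \<open>Both \<open>v k\<close> and \<open>w k\<close> lie close to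
      \<open>u k\<close>; this makes their limits along \<open>p\<close> coincide.\<close>
    have wv: "norm (w k - v k) \<le> \<gamma> * a k + \<theta> * a (Suc k)" for k
      using norm_triangle_ineq[of "u k - v k" "w k - u k"] uv[of k] uw[of k]
      by (simp add: norm_minus_commute)
    have "(\<lambda>k. \<gamma> * a k + \<theta> * a (Suc k)) \<longlonglongrightarrow> 0"
      using a0 aS by (auto intro!: tendsto_eq_intros)
    from sub[OF this] have wp: "(\<lambda>j. w (p j)) \<longlonglongrightarrow> s"
      by (rule tendsto_perturb[OF vp wv])
    have Hx: "(\<lambda>j. H (x (p j))) \<longlonglongrightarrow> H xbar" and Gx: "(\<lambda>j. G (x (Suc (p j)))) \<longlonglongrightarrow> G xbar"
      using continuous_on_tendsto_compose[OF contH xp] continuous_on_tendsto_compose[OF contG xSp]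
      by simp_all
    \<comment> \<open>The \<open>- 0\<close> is the limit of the error term, kept to match the shape
      given by \<open>tendsto_diff\<close>.\<close>
    have "H xbar + s \<bullet> (y - xbar) - 0 \<le> H y" for y
    proof (rule LIMSEQ_le_const2)
      show "(\<lambda>j. H (x (p j)) + v (p j) \<bullet> (y - x (p j)) - \<rho> * (a (p j))\<^sup>2)
          \<longlonglongrightarrow> H xbar + s \<bullet> (y - xbar) - 0"
        by (intro tendsto_diff tendsto_add tendsto_inner tendsto_const Hx vp xp sub[OF e0])
    qed (use v in blast)
    moreover have "G xbar + s \<bullet> (y - xbar) - 0 \<le> G y" if "y \<in> C" for y
    proof (rule LIMSEQ_le_const2)
      show "(\<lambda>j. G (x (Suc (p j))) + w (p j) \<bullet> (y - x (Suc (p j))) - \<zeta> (p j))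
          \<longlonglongrightarrow> G xbar + s \<bullet> (y - xbar) - 0"
        by (intro tendsto_diff tendsto_add tendsto_inner tendsto_const Gx wp xSp sub[OF assms(22)])
    qed (use w that in blast)
    \<comment> \<open>Outside \<open>C\<close> the value of \<open>g\<close> is \<infinity>, so for
      \<open>g\<close> the inequality on \<open>C\<close> suffices.\<close>
    ultimately have "s \<in> subdiff h xbar" and "s \<in> subdiff g xbar"
      by (auto simp: subdiff_def h gC xbar)
    then show ?thesis
      by (auto simp: critical_point_def)
  qed
  ultimately show ?thesis by simp
qed

end
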